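(* Let $n>0$. Then the poset $(\mathcal{W}(B_n),\leqslant_R)$ is isomorphic to the product poset $(B_{\lceil n/2\rceil},\leqslant_R)\times\mathcal{P}([\lfloor n/2\rfloor])$, where $\mathcal{P}([\lfloor n/2\rfloor])$ is ordered by inclusion. In particular, $(\mathcal{W}(B_n),\leqslant_R)$ is a complemented lattice.
   Context: For $k\ge1$, $B_k$ is the group of bijections $w$ of $[\pm k]=\{-k,\dots,-1,1,\dots,k\}$ with $w(-a)=-w(a)$; it is a Coxeter group with simple generators $S=\{(1,-1)\}\cup\{(a,a+1)(-a,-a-1):a\in[k-1]\}$ and length $\ell_B$. The right weak order $\leqslant_R$ is the partial order on $B_k$ generated by the covers $u\vartriangleleft_R us$ for $s\in S$ with $\ell_B(us)=\ell_B(u)+1$. For $a\in[n]$ let $a^*=a-1$ if $a$ even, $a^*=a+1$ if $a$ odd and $a+1\le n$, $a^*=n$ otherwise. The signed Wachs permutations are $\mathcal{W}(B_n)=\{v\in B_n: |v^{-1}(a)-v^{-1}(a^* )|\le1\ \forall a\in[n-1]\}$, ordered by the restriction of $\leqslant_R$ on $B_n$. *)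

theory Defs
  imports Complex_Main "HOL-Algebra.Lattice" "HOL-Combinatorics.Permutations"
begin

definition pm_interval :: "nat \<Rightarrow> int set" where
  "pm_interval k = {- int k..int k} - {0}"

text \<open>Signed permutations are extended by the identity outside \<^term>\<open>pm_interval k\<close>
  (this is part of \<^const>\<open>permutes\<close>), so that the group operation is composition and
  \<^term>\<open>u \<circ> s\<close> applies \<^term>\<open>s\<close> first.\<close>

definition signed_perms :: "nat \<Rightarrow> (int \<Rightarrow> int) set" where
  "signed_perms k =
     {w. w permutes pm_interval k \<and> (\<forall>a\<in>pm_interval k. w (- a) = - w a)}"

definition simple_gens :: "nat \<Rightarrow> (int \<Rightarrow> int) set" where
  "simple_gens k =
     {Transposition.transpose 1 (- 1)} \<union>
     {Transposition.transpose a (a + 1) \<circ> Transposition.transpose (- a) (- a - 1) | a.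
        a \<in> {1..int k - 1}}"

definition length_B :: "nat \<Rightarrow> (int \<Rightarrow> int) \<Rightarrow> nat" where
  "length_B k w =
     (LEAST r. \<exists>ss. length ss = r \<and> set ss \<subseteq> simple_gens k \<and> w = foldr (\<circ>) ss id)"

definition weak_cover :: "nat \<Rightarrow> (int \<Rightarrow> int) \<Rightarrow> (int \<Rightarrow> int) \<Rightarrow> bool" where
  "weak_cover k u v \<longleftrightarrow>
     u \<in> signed_perms k \<and>
     (\<exists>s\<in>simple_gens k. v = u \<circ> s \<and> length_B k (u \<circ> s) = length_B k u + 1)"

definition weak_le :: "nat \<Rightarrow> (int \<Rightarrow> int) \<Rightarrow> (int \<Rightarrow> int) \<Rightarrow> bool" where
  "weak_le k = (weak_cover k)\<^sup>*\<^sup>*"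

definition star :: "nat \<Rightarrow> nat \<Rightarrow> nat" where
  "star n a = (if even a then a - 1 else if a + 1 \<le> n then a + 1 else n)"

definition signed_wachs :: "nat \<Rightarrow> (int \<Rightarrow> int) set" where
  "signed_wachs n =
     {v \<in> signed_perms n.
        \<forall>a\<in>{1..n - 1}. \<bar>inv_into UNIV v (int a) - inv_into UNIV v (int (star n a))\<bar> \<le> 1}"

definition B_poset :: "nat \<Rightarrow> (int \<Rightarrow> int) gorder" where
  "B_poset k = \<lparr>carrier = signed_perms k, eq = (=), le = weak_le k\<rparr>"

definition wachs_poset :: "nat \<Rightarrow> (int \<Rightarrow> int) gorder" where
  "wachs_poset n = \<lparr>carrier = signed_wachs n, eq = (=), le = weak_le n\<rparr>"

definition powerset_poset :: "'a set \<Rightarrow> 'a set gorder" where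
  "powerset_poset X = \<lparr>carrier = Pow X, eq = (=), le = (\<subseteq>)\<rparr>"

definition prod_poset :: "'a gorder \<Rightarrow> 'b gorder \<Rightarrow> ('a \<times> 'b) gorder" where
  "prod_poset P Q =
     \<lparr>carrier = carrier P \<times> carrier Q, eq = (=),
      le = (\<lambda>x y. fst x \<sqsubseteq>\<^bsub>P\<^esub> fst y \<and> snd x \<sqsubseteq>\<^bsub>Q\<^esub> snd y)\<rparr>"

definition poset_isomorphic :: "'a gorder \<Rightarrow> 'b gorder \<Rightarrow> bool" where
  "poset_isomorphic P Q \<longleftrightarrow>
     partial_order P \<and> partial_order Q \<and>
     (\<exists>f. bij_betw f (carrier P) (carrier Q) \<and> order_emb P Q f)"

locale complemented_bounded_lattice = bounded_lattice +
  assumes complement_exists: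
    "x \<in> carrier L \<Longrightarrow> \<exists>y\<in>carrier L. x \<sqinter> y = \<bottom> \<and> x \<squnion> y = \<top>"

end

theory Submission
  imports Defs
begin

text \<open>
  Record a signed permutation \<open>v\<close> by its inversion set in terms of values: the pairs \<open>a < b\<close> with
  \<open>v\<^sup>-\<^sup>1(b) < v\<^sup>-\<^sup>1(a)\<close>. The right weak order is inclusion of inversion sets, and the inversion sets
  are exactly the biclosed sets, i.e. those stable under \<open>(a, b) \<mapsto> (-b, -a)\<close> that are transitive
  and have transitive complement. The transitive closure of a union of two biclosed sets is biclosed,
  which gives joins; complementation of sets gives meets and lattice complements.

  In a signed Wachs permutation the values \<open>2i - 1\<close> and \<open>2i\<close> stand side by side, so whether a pair
  from two different blocks is inverted depends on the blocks only. The inversion set is therefore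
  the same data as a biclosed set of pairs of blocks, that is a signed permutation of the blocks,
  together with the set of blocks that are internally inverted.
\<close>

subsection \<open>Signed permutations\<close>

lemma pm_interval_iff: "a \<in> pm_interval k \<longleftrightarrow> a \<noteq> 0 \<and> \<bar>a\<bar> \<le> int k"
  by (auto simp: pm_interval_def)

lemma finite_pm_interval [simp]: "finite (pm_interval k)"
  by (simp add: pm_interval_def)

lemma uminus_pm_interval [simp]: "- a \<in> pm_interval k \<longleftrightarrow> a \<in> pm_interval k"
  by (simp add: pm_interval_iff)

lemma signed_perms_permutes: "w \<in> signed_perms k \<Longrightarrow> w permutes pm_interval k"
  by (simp add: signed_perms_def)

text \<open>Outside \<open>pm_interval k\<close> a signed permutation is the identity, so oddness
  extends to all integers.\<close>

lemma signed_perms_uminus: "w \<in> signed_perms k \<Longrightarrow> w (- a) = - w a"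
  by (cases "a \<in> pm_interval k") (auto simp: signed_perms_def permutes_not_in)

lemma signed_perms_in_iff: "w \<in> signed_perms k \<Longrightarrow> w a \<in> pm_interval k \<longleftrightarrow> a \<in> pm_interval k"
  by (simp add: permutes_in_image signed_perms_permutes)

lemma signed_perms_inv_in_iff:
  "w \<in> signed_perms k \<Longrightarrow> inv w a \<in> pm_interval k \<longleftrightarrow> a \<in> pm_interval k"
  by (meson permutes_in_image permutes_inv signed_perms_permutes)

lemma signed_perms_inv_apply [simp]: "w \<in> signed_perms k \<Longrightarrow> inv w (w a) = a"
  by (metis permutes_inverses(2) signed_perms_permutes)

lemma signed_perms_apply_inv [simp]: "w \<in> signed_perms k \<Longrightarrow> w (inv w a) = a"
  by (metis permutes_inverses(1) signed_perms_permutes)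

lemma signed_perms_inv_uminus:
  assumes "w \<in> signed_perms k"
  shows "inv w (- a) = - inv w a"
proof -
  have "inv w (w (- inv w a)) = - inv w a" using assms by (rule signed_perms_inv_apply)
  then show ?thesis by (simp add: signed_perms_uminus[OF assms] signed_perms_apply_inv[OF assms])
qed

lemma signed_perms_inv_eq_iff: "w \<in> signed_perms k \<Longrightarrow> inv w a = inv w b \<longleftrightarrow> a = b"
  by (metis signed_perms_apply_inv)

lemma id_in_signed_perms [simp]: "id \<in> signed_perms k"
  by (simp add: signed_perms_def permutes_id)

lemma comp_in_signed_perms:
  assumes "u \<in> signed_perms k" "v \<in> signed_perms k"
  shows "u \<circ> v \<in> signed_perms k"
  using assms permutes_compose[OF signed_perms_permutes[OF assms(2)] signed_perms_permutes[OF assms(1)]]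
  by (simp add: signed_perms_def[of k] signed_perms_uminus[OF assms(1)])

subsection \<open>Inversion sets and biclosed sets\<close>

definition increasing_pairs :: "nat \<Rightarrow> (int \<times> int) set" where
  "increasing_pairs k = {(a, b). a \<in> pm_interval k \<and> b \<in> pm_interval k \<and> a < b}"

lemma finite_increasing_pairs [simp]: "finite (increasing_pairs k)"
  by (rule finite_subset[of _ "pm_interval k \<times> pm_interval k"]) (auto simp: increasing_pairs_def)

definition inversions :: "nat \<Rightarrow> (int \<Rightarrow> int) \<Rightarrow> (int \<times> int) set" where
  "inversions k w = {(a, b) \<in> increasing_pairs k. inv w b < inv w a}"

text \<open>The orbits of \<open>(a, b) -> (- b, - a)\<close> on increasing pairs correspond to the
  positive roots of type B. The last clause is transitivity of the complement in
  \<open>increasing_pairs k\<close>, read contrapositively.\<close>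

definition biclosed :: "nat \<Rightarrow> (int \<times> int) set \<Rightarrow> bool" where
  "biclosed k I \<longleftrightarrow>
     I \<subseteq> increasing_pairs k \<and>
     (\<forall>a b. (a, b) \<in> I \<longrightarrow> (- b, - a) \<in> I) \<and>
     (\<forall>a b c. (a, b) \<in> I \<longrightarrow> (b, c) \<in> I \<longrightarrow> (a, c) \<in> I) \<and>
     (\<forall>a b c. (a, c) \<in> I \<longrightarrow> b \<in> pm_interval k \<longrightarrow> a < b \<longrightarrow> b < c \<longrightarrow> (a, b) \<in> I \<or> (b, c) \<in> I)"

lemma biclosed_subset: "biclosed k I \<Longrightarrow> I \<subseteq> increasing_pairs k"
  and biclosed_uminus: "biclosed k I \<Longrightarrow> (a, b) \<in> I \<Longrightarrow> (- b, - a) \<in> I"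
  and biclosed_trans: "biclosed k I \<Longrightarrow> (a, b) \<in> I \<Longrightarrow> (b, c) \<in> I \<Longrightarrow> (a, c) \<in> I"
  and biclosed_cotrans: "biclosed k I \<Longrightarrow> (a, c) \<in> I \<Longrightarrow> b \<in> pm_interval k \<Longrightarrow> a < b \<Longrightarrow> b < c \<Longrightarrow>
    (a, b) \<in> I \<or> (b, c) \<in> I"
  by (auto simp: biclosed_def)

lemma biclosed_uminus_iff: "biclosed k I \<Longrightarrow> (- b, - a) \<in> I \<longleftrightarrow> (a, b) \<in> I"
  using biclosed_uminus[of k I a b] biclosed_uminus[of k I "- b" "- a"] by auto

lemma inversions_subset: "inversions k w \<subseteq> increasing_pairs k"
  by (auto simp: inversions_def)

lemma finite_inversions [simp]: "finite (inversions k w)"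
  by (rule finite_subset[OF inversions_subset]) simp

lemma inversions_id [simp]: "inversions k id = {}"
  by (auto simp: inversions_def increasing_pairs_def)

lemma biclosed_inversions: "w \<in> signed_perms k \<Longrightarrow> biclosed k (inversions k w)"
  by (auto simp: biclosed_def inversions_def increasing_pairs_def signed_perms_inv_uminus)

text \<open>The order in which the values occur in the one-line notation of a signed permutation with
  inversion set \<open>I\<close>.\<close>

definition before :: "(int \<times> int) set \<Rightarrow> int \<Rightarrow> int \<Rightarrow> bool" where
  "before I x y \<longleftrightarrow> x < y \<and> (x, y) \<notin> I \<or> y < x \<and> (y, x) \<in> I"

text \<open>For each relative size order of the three values, a failure would contradict
  transitivity or cotransitivity of \<open>I\<close>.\<close>

lemma before_trans:
  assumes "biclosed k I" "x \<in> pm_interval k" "y \<in> pm_interval k" "z \<in> pm_interval k"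
    and "before I x y" "before I y z"
  shows "before I x z"
proof -
  have "x \<noteq> z" using assms(5,6) by (auto simp: before_def)
  then show ?thesis
    using assms biclosed_trans[OF assms(1)] biclosed_cotrans[OF assms(1)]
    unfolding before_def by (meson linorder_neqE_linordered_idom order_less_trans)
qed

lemma before_inversions:
  assumes "w \<in> signed_perms k" "x \<in> pm_interval k" "y \<in> pm_interval k"
  shows "before (inversions k w) x y \<longleftrightarrow> inv w x < inv w y"
  using assms signed_perms_inv_eq_iff[OF assms(1), of x y]
  by (auto simp: before_def inversions_def increasing_pairs_def)

lemma biclosed_memD_before: "biclosed k I \<Longrightarrow> (a, b) \<in> I \<Longrightarrow> before I b a"
  using biclosed_subset[of k I] by (auto simp: before_def increasing_pairs_def)

section \<open>Neighbouring positions, and recovery of a permutation from its inversions\<close>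

definition consecutive :: "nat \<Rightarrow> int \<Rightarrow> int \<Rightarrow> bool" where
  "consecutive k i j \<longleftrightarrow>
     i \<in> pm_interval k \<and> j \<in> pm_interval k \<and> i < j \<and> (\<forall>c\<in>pm_interval k. \<not> (i < c \<and> c < j))"

text \<open>Since 0 is missing, -1 and 1 are neighbours. The three cases correspond to the sign
  change, the adjacent swaps at positive positions, and their mirror images.\<close>

lemma consecutive_cases:
  assumes "consecutive k i j"
  obtains "i = - 1" "j = 1" | "j = i + 1" "1 \<le> i" "i < int k" | "j = i + 1" "i < -1" "- int k \<le> i"
proof -
  have ij: "i \<noteq> 0" "j \<noteq> 0" "\<bar>i\<bar> \<le> int k" "\<bar>j\<bar> \<le> int k" "i < j"
    and c: "\<And>c. c \<noteq> 0 \<Longrightarrow> \<bar>c\<bar> \<le> int k \<Longrightarrow> i < c \<Longrightarrow> c < j \<Longrightarrow> False"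
    using assms by (auto simp: consecutive_def pm_interval_iff)
  show thesis
  proof (cases "i = -1")
    case True
    then show thesis using c[of 1] ij that(1) by force
  next
    case False
    then have "j = i + 1" using c[of "i + 1"] ij by force
    then show thesis using False ij that(2,3) by force
  qed
qed

text \<open>Reduces an order condition on all positions to neighbouring ones, where simple
  generators act. The induction cuts at an intermediate position.\<close>

lemma consecutive_chain:
  assumes step: "\<And>i j. consecutive k i j \<Longrightarrow> R i j"
    and trans: "\<And>i j l. i \<in> pm_interval k \<Longrightarrow> j \<in> pm_interval k \<Longrightarrow> l \<in> pm_interval k \<Longrightarrow>
      R i j \<Longrightarrow> R j l \<Longrightarrow> R i l"
    and "i \<in> pm_interval k" "j \<in> pm_interval k" "i < j"
  shows "R i j"
  using assms(3-)
proof (induction "nat (j - i)" arbitrary: i j rule: less_induct)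
  case less
  show ?case
  proof (cases "consecutive k i j")
    case True
    then show ?thesis by (rule step)
  next
    case False
    then obtain c where c: "c \<in> pm_interval k" "i < c" "c < j"
      using less.prems by (auto simp: consecutive_def)
    then have "R i c" "R c j"
      using less.prems by (auto intro!: less.hyps)
    then show ?thesis using trans less.prems c by blast
  qed
qed

text \<open>Consider the least moved point \<open>i\<close>. Its image cannot be smaller, since
  smaller points are fixed. If it is larger, the preimage of \<open>i\<close> lies above
  \<open>i\<close> but is mapped below \<open>f i\<close>.\<close>

lemma strict_mono_permutes_eq_id:
  fixes f :: "'a::linorder \<Rightarrow> 'a"
  assumes "f permutes A" "finite A" and mono: "\<And>x y. x \<in> A \<Longrightarrow> y \<in> A \<Longrightarrow> x < y \<Longrightarrow> f x < f y"
  shows "f = id"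
proof (rule ccontr)
  assume "f \<noteq> id"
  define D where "D = {x \<in> A. f x \<noteq> x}"
  have "D \<noteq> {}" using \<open>f \<noteq> id\<close> assms(1) by (force simp: D_def permutes_not_in)
  moreover have "finite D" using assms by (simp add: D_def)
  ultimately have i: "Min D \<in> D" and le: "\<And>x. x \<in> D \<Longrightarrow> Min D \<le> x" by auto
  define i where "i = Min D"
  have iA: "i \<in> A" "f i \<noteq> i" using i by (auto simp: D_def i_def)
  have fixed: "f x = x" if "x \<in> A" "x < i" for x
    using le[of x] that unfolding D_def[symmetric] i_def[symmetric] by (force simp: D_def)
  have fiA: "f i \<in> A" using iA assms(1) by (simp add: permutes_in_image)
  obtain j where j: "f j = i" "j \<in> A" using assms(1) iA by (metis permutes_surj permutes_in_image surjD)
  have "inj f" using assms(1) by (rule permutes_inj)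
  show False
  proof (cases "f i < i")
    case True
    then show False using fixed[OF fiA] \<open>inj f\<close> iA by (metis injD)
  next
    case False
    then have "i < f i" using iA by auto
    moreover have "i < j" using j fixed[of j] iA by (metis linorder_neqE)
    ultimately show False using mono[OF iA(1) j(2)] j by auto
  qed
qed

text \<open>The inversion set determines which of any two values comes first, so
  \<open>inv v \<circ> u\<close> is increasing on positions.\<close>

lemma inversions_inject:
  assumes u: "u \<in> signed_perms k" and v: "v \<in> signed_perms k"
    and eq: "inversions k u = inversions k v"
  shows "u = v"
proof -
  have "inv v \<circ> u permutes pm_interval k"
    by (intro permutes_compose permutes_inv signed_perms_permutes u v)
  moreover have "(inv v \<circ> u) x < (inv v \<circ> u) y"
    if "x \<in> pm_interval k" "y \<in> pm_interval k" "x < y" for x y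
    using that before_inversions[OF u, of "u x" "u y"] before_inversions[OF v, of "u x" "u y"]
    by (simp add: eq signed_perms_in_iff[OF u] signed_perms_inv_apply[OF u])
  ultimately have "inv v \<circ> u = id"
    by (intro strict_mono_permutes_eq_id[of _ "pm_interval k"]) auto
  then show ?thesis
    by (metis comp_apply ext id_apply signed_perms_apply_inv v)
qed

subsection \<open>The weak order as inclusion of inversion sets\<close>

text \<open>Treats the sign change and the adjacent swaps uniformly: the only position pairs put out
  of order are \<open>(i, j)\<close> and its mirror, which coincide for the sign change.\<close>

definition swaps_adjacent :: "nat \<Rightarrow> (int \<Rightarrow> int) \<Rightarrow> int \<Rightarrow> int \<Rightarrow> bool" where
  "swaps_adjacent k s i j \<longleftrightarrow>
     s \<in> signed_perms k \<and> s \<circ> s = id \<and> i \<in> pm_interval k \<and> j \<in> pm_interval k \<and> i < j \<and>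
     s i = j \<and> s j = i \<and>
     (\<forall>p\<in>pm_interval k. \<forall>q\<in>pm_interval k.
        p < q \<longrightarrow> (s p < s q \<longleftrightarrow> (p, q) \<noteq> (i, j) \<and> (p, q) \<noteq> (- j, - i)))"

lemma transpose_comp_in_signed_perms:
  assumes "a \<in> pm_interval k" "b \<in> pm_interval k" "a \<noteq> b" "a \<noteq> -b"
  shows "Transposition.transpose a b \<circ> Transposition.transpose (- a) (- b) \<in> signed_perms k"
    (is "?s \<in> _")
proof -
  have "?s permutes pm_interval k"
    using assms by (intro permutes_compose permutes_swap_id) auto
  moreover have "?s (- x) = - ?s x" for x
    using assms by (simp add: Transposition.transpose_def pm_interval_iff)
  ultimately show ?thesis by (simp add: signed_perms_def)
qed

lemma swaps_adjacent_zero: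
  assumes "k > 0"
  shows "swaps_adjacent k (Transposition.transpose 1 (- 1)) (- 1) 1"
proof -
  have "Transposition.transpose 1 (- 1) permutes pm_interval k"
    by (rule permutes_swap_id) (use assms in \<open>auto simp: pm_interval_iff\<close>)
  then show ?thesis using assms
    by (auto simp: swaps_adjacent_def signed_perms_def Transposition.transpose_def pm_interval_iff fun_eq_iff)
qed

lemma swaps_adjacent_pos:
  assumes "1 \<le> a" "a < int k"
  shows "swaps_adjacent k (Transposition.transpose a (a + 1) \<circ> Transposition.transpose (- a) (- a - 1)) a (a + 1)"
    (is "swaps_adjacent k ?s _ _")
proof -
  have "?s \<in> signed_perms k"
    using transpose_comp_in_signed_perms[of a k "a + 1"] assms by (simp add: pm_interval_iff)
  then show ?thesis using assms
    by (auto simp: swaps_adjacent_def Transposition.transpose_def pm_interval_iff fun_eq_iff)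
qed

lemma swaps_adjacent_uminus: 
  assumes "swaps_adjacent k s i j" shows "swaps_adjacent k s (- j) (- i)"
proof -
  have "s \<in> signed_perms k" using assms by (simp add: swaps_adjacent_def)
  with assms signed_perms_uminus[OF this] show ?thesis
    unfolding swaps_adjacent_def by auto
qed

lemma simple_gens_swaps_adjacent:
  assumes "k > 0" "s \<in> simple_gens k"
  obtains i j where "swaps_adjacent k s i j"
proof -
  consider "s = Transposition.transpose 1 (- 1)"
    | a where "1 \<le> a" "a < int k"
        "s = Transposition.transpose a (a + 1) \<circ> Transposition.transpose (- a) (- a - 1)"
    using assms(2) by (force simp: simple_gens_def)
  then show thesis
    by cases (use that swaps_adjacent_zero[OF assms(1)] swaps_adjacent_pos in blast)+
qed

lemma consecutive_swaps_adjacent: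
  assumes "k > 0" "consecutive k i j"
  obtains s where "s \<in> simple_gens k" "swaps_adjacent k s i j"
  using assms(2)
proof (cases rule: consecutive_cases)
  case 1
  then show thesis using that swaps_adjacent_zero[OF assms(1)] by (auto simp: simple_gens_def)
next
  case 2
  then show thesis using that[OF _ swaps_adjacent_pos[of i k, folded 2(1)]] by (auto simp: simple_gens_def)
next
  case 3
  \<comment> \<open>A negative pair is the mirror of the positive pair
    \<open>(- j, - j + 1)\<close>, whose generator swaps both.\<close>
  then have a: "1 \<le> - j" "- j < int k" "- (- j) = j" "- (- j + 1) = i" by auto
  show thesis
    using that[OF _ swaps_adjacent_uminus[OF swaps_adjacent_pos[OF a(1,2)], unfolded a(3,4)]] a
    by (fastforce simp: simple_gens_def)
qed

text \<open>The condition \<open>0 \<le> a + b\<close> selects one element of each orbit of the symmetry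
  \<open>(a, b) \<mapsto> (-b, -a)\<close>.\<close>

definition inversion_number :: "nat \<Rightarrow> (int \<Rightarrow> int) \<Rightarrow> nat" where
  "inversion_number k w = card {(a, b) \<in> inversions k w. 0 \<le> a + b}"

text \<open>Only the values at positions \<open>i\<close>, \<open>j\<close> and at their mirrors
  change their relative order. The two new inversions form one orbit, which is counted once.\<close>

lemma inversions_comp_ascent:
  assumes w: "w \<in> signed_perms k" and s: "swaps_adjacent k s i j" and "w i < w j"
  shows "inversions k (w \<circ> s) = inversions k w \<union> {(w i, w j), (- w j, - w i)}"
    and "inversion_number k (w \<circ> s) = inversion_number k w + 1"
proof -
  have sB: "s \<in> signed_perms k" and ss: "s \<circ> s = id" and ij: "i \<in> pm_interval k" "j \<in> pm_interval k" "i < j"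
    and sij: "s i = j" "s j = i"
    and s_mono: "\<And>p q. p \<in> pm_interval k \<Longrightarrow> q \<in> pm_interval k \<Longrightarrow> p < q \<Longrightarrow>
      s p < s q \<longleftrightarrow> (p, q) \<noteq> (i, j) \<and> (p, q) \<noteq> (- j, - i)"
    using s by (simp_all add: swaps_adjacent_def)
  have inv_s: "inv s = s" using ss by (metis inv_unique_comp)
  have inv_ws: "inv (w \<circ> s) = s \<circ> inv w"
    using o_inv_distrib[of w s] w sB inv_s by (metis permutes_bij signed_perms_permutes)
  have pos: "inv w x = p \<longleftrightarrow> x = w p" for x p using w by auto
  have inj: "s p = s q \<longleftrightarrow> p = q" for p q by (metis ss comp_apply id_apply)
  have mem: "(a, b) \<in> inversions k (w \<circ> s) \<longleftrightarrow>
    (a, b) \<in> inversions k w \<or> (a, b) = (w i, w j) \<or> (a, b) = (- w j, - w i)" for a b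
  proof (cases "(a, b) \<in> increasing_pairs k")
    case True
    then have ab: "inv w a \<in> pm_interval k" "inv w b \<in> pm_interval k" "a < b" "inv w a \<noteq> inv w b"
      using w by (auto simp: increasing_pairs_def signed_perms_inv_in_iff signed_perms_inv_eq_iff)
    have eq1: "(inv w x, inv w y) = (i, j) \<longleftrightarrow> (x, y) = (w i, w j)" for x y by (auto simp: pos)
    have eq2: "(inv w x, inv w y) = (- j, - i) \<longleftrightarrow> (x, y) = (- w j, - w i)" for x y
      by (auto simp: pos signed_perms_uminus[OF w])
    show ?thesis
    proof (cases "inv w a < inv w b")
      case True
      then have "(a, b) \<notin> inversions k w" by (auto simp: inversions_def)
      moreover have "s (inv w b) < s (inv w a) \<longleftrightarrow> \<not> s (inv w a) < s (inv w b)"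
        using inj[of "inv w a" "inv w b"] ab by auto
      ultimately show ?thesis
        using s_mono[OF ab(1,2) True] \<open>(a, b) \<in> increasing_pairs k\<close> eq1[of a b] eq2[of a b]
        by (simp add: inversions_def inv_ws)
    next
      case False
      then have lt: "inv w b < inv w a" using ab by auto
      then have "(a, b) \<in> inversions k w" using \<open>(a, b) \<in> increasing_pairs k\<close> by (simp add: inversions_def)
      moreover have "(b, a) \<noteq> (w i, w j)" "(b, a) \<noteq> (- w j, - w i)" using \<open>w i < w j\<close> ab by auto
      then have "s (inv w b) < s (inv w a)"
        using s_mono[OF ab(2,1) lt] eq1[of b a] eq2[of b a] by blast
      ultimately show ?thesis
        using \<open>(a, b) \<in> increasing_pairs k\<close> by (simp add: inversions_def inv_ws)
    qed
  next
    case False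
    moreover have "(w i, w j) \<in> increasing_pairs k" "(- w j, - w i) \<in> increasing_pairs k"
      using ij w \<open>w i < w j\<close> by (auto simp: increasing_pairs_def signed_perms_in_iff)
    ultimately show ?thesis by (auto simp: inversions_def)
  qed
  then show eq: "inversions k (w \<circ> s) = inversions k w \<union> {(w i, w j), (- w j, - w i)}" by auto
  \<comment> \<open>The counted representative of the new orbit. If \<open>w i + w j = 0\<close>,
    the two new pairs are equal, so the choice is consistent.\<close>
  define p where "p = (if 0 \<le> w i + w j then (w i, w j) else (- w j, - w i))"
  have "{(a, b) \<in> inversions k (w \<circ> s). 0 \<le> a + b} = insert p {(a, b) \<in> inversions k w. 0 \<le> a + b}"
    unfolding eq p_def by auto
  moreover have "p \<notin> inversions k w"
    using ij w by (auto simp: p_def inversions_def signed_perms_inv_uminus)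
  moreover have "finite {(a, b) \<in> inversions k w. 0 \<le> a + b}"
    by (rule finite_subset[of _ "inversions k w"]) auto
  ultimately show "inversion_number k (w \<circ> s) = inversion_number k w + 1"
    unfolding inversion_number_def by (simp add: case_prod_unfold)
qed

lemma simple_gens_signed_perms: "k > 0 \<Longrightarrow> s \<in> simple_gens k \<Longrightarrow> s \<in> signed_perms k"
  by (metis simple_gens_swaps_adjacent swaps_adjacent_def)

text \<open>Since \<open>s\<close> is an involution, a descent of \<open>w\<close> is an ascent of
  \<open>w \<circ> s\<close>.\<close>

lemma simple_gens_ascent_or_descent:
  assumes "k > 0" "w \<in> signed_perms k" "s \<in> simple_gens k"
  obtains "inversions k w \<subseteq> inversions k (w \<circ> s)" "inversion_number k (w \<circ> s) = inversion_number k w + 1"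
    | "inversion_number k w = inversion_number k (w \<circ> s) + 1"
proof -
  obtain i j where s: "swaps_adjacent k s i j"
    using assms simple_gens_swaps_adjacent by blast
  then have sB: "s \<in> signed_perms k" and ss: "s \<circ> s = id" and "i < j" "s i = j" "s j = i"
    by (auto simp: swaps_adjacent_def)
  have "w i \<noteq> w j" using \<open>i < j\<close> assms(2) by (metis less_irrefl signed_perms_inv_apply)
  then consider "w i < w j" | "(w \<circ> s) i < (w \<circ> s) j" using \<open>s i = j\<close> \<open>s j = i\<close> by fastforce
  then show thesis
  proof cases
    case 1
    then show thesis using inversions_comp_ascent[OF assms(2) s] that(1) by blast
  next
    case 2
    have "(w \<circ> s) \<circ> s = w" using ss by (simp add: comp_assoc)
    then show thesis
      using inversions_comp_ascent(2)[OF comp_in_signed_perms[OF assms(2) sB] s 2] that(2) by metis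
  qed
qed

text \<open>Stands in for \<open>weak_cover\<close> until \<open>length_B\<close> has been
  identified with the inversion number.\<close>

definition ascent_step :: "nat \<Rightarrow> (int \<Rightarrow> int) \<Rightarrow> (int \<Rightarrow> int) \<Rightarrow> bool" where
  "ascent_step k u v \<longleftrightarrow>
     u \<in> signed_perms k \<and>
     (\<exists>s\<in>simple_gens k. v = u \<circ> s \<and> inversions k u \<subseteq> inversions k v \<and>
        inversion_number k v = inversion_number k u + 1)"

text \<open>If no ascent of \<open>w\<close> were available inside \<open>I\<close>, then consecutive entries of \<open>w\<close>, hence all
  of them, would be ordered as prescribed by \<open>I\<close>.\<close>

lemma ascent_step_within_biclosed:
  assumes "k > 0" and w: "w \<in> signed_perms k" and I: "biclosed k I"
    and sub: "inversions k w \<subset> I"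
  obtains v where "ascent_step k w v" "v \<in> signed_perms k" "inversions k v \<subseteq> I"
proof -
  have "\<exists>i j. consecutive k i j \<and> \<not> before I (w i) (w j)"
  proof (rule ccontr)
    assume "\<not> ?thesis"
    then have all: "before I (w i) (w j)" if "i \<in> pm_interval k" "j \<in> pm_interval k" "i < j" for i j
      using consecutive_chain[of k "\<lambda>i j. before I (w i) (w j)" i j] that before_trans[OF I]
        signed_perms_in_iff[OF w] by blast
    have "(a, b) \<in> inversions k w" if ab: "(a, b) \<in> I" for a b
    proof (rule ccontr)
      assume "(a, b) \<notin> inversions k w"
      have inc: "(a, b) \<in> increasing_pairs k" using ab biclosed_subset[OF I] by blast
      then have "inv w a < inv w b"
        using \<open>(a, b) \<notin> inversions k w\<close> signed_perms_inv_eq_iff[OF w, of a b]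
        by (auto simp: inversions_def increasing_pairs_def)
      then have "before I a b"
        using all[of "inv w a" "inv w b"] inc w by (auto simp: increasing_pairs_def signed_perms_inv_in_iff)
      then show False using ab inc by (auto simp: before_def increasing_pairs_def)
    qed
    then show False using sub by auto
  qed
  then obtain i j where ij: "consecutive k i j" and nb: "\<not> before I (w i) (w j)" by blast
  obtain s where s: "s \<in> simple_gens k" "swaps_adjacent k s i j"
    using consecutive_swaps_adjacent[OF assms(1) ij] by blast
  have ij': "i \<in> pm_interval k" "j \<in> pm_interval k" "i < j" using ij by (auto simp: consecutive_def)
  have wij: "w i \<noteq> w j" using ij' w by (metis less_irrefl signed_perms_inv_apply)
  \<comment> \<open>A descent here would be an inversion of \<open>w\<close>, hence in
    \<open>I\<close>, and \<open>I\<close> would then order the two values as \<open>w\<close>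
    does.\<close>
  have "w i < w j"
  proof (rule ccontr)
    assume "\<not> w i < w j"
    then have "(w j, w i) \<in> inversions k w"
      using wij ij' w by (auto simp: inversions_def increasing_pairs_def signed_perms_in_iff)
    then show False using sub nb biclosed_memD_before[OF I, of "w j" "w i"] by auto
  qed
  then have "(w i, w j) \<in> I" using nb by (auto simp: before_def)
  then have "(w i, w j) \<in> I" "(- w j, - w i) \<in> I" using biclosed_uminus[OF I] by auto
  with inversions_comp_ascent[OF w s(2) \<open>w i < w j\<close>] sub s w
  have "ascent_step k w (w \<circ> s)" "inversions k (w \<circ> s) \<subseteq> I" by (auto simp: ascent_step_def)
  then show thesis
    using that comp_in_signed_perms[OF w simple_gens_signed_perms[OF assms(1) s(1)]] by blast
qed

lemma inversion_number_le: "inversion_number k w \<le> card (increasing_pairs k)"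
  unfolding inversion_number_def
  by (rule card_mono) (use inversions_subset in auto)

text \<open>Ascents inside \<open>I\<close> exist until all of \<open>I\<close> is reached, and the
  bounded inversion number forces termination. From \<open>id\<close> this realises every biclosed
  set; with \<open>I\<close> an inversion set it produces chains in the weak order.\<close>

lemma biclosed_reachable:
  assumes "k > 0" "w \<in> signed_perms k" and I: "biclosed k I" and "inversions k w \<subseteq> I"
  obtains v where "v \<in> signed_perms k" "inversions k v = I" "(ascent_step k)\<^sup>*\<^sup>* w v"
proof -
  have "\<exists>v\<in>signed_perms k. inversions k v = I \<and> (ascent_step k)\<^sup>*\<^sup>* w v"
    using assms(2,4)
  proof (induction "card (increasing_pairs k) - inversion_number k w" arbitrary: w rule: less_induct)
    case less
    show ?case
    proof (cases "inversions k w = I")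
      case True
      then show ?thesis using less.prems by blast
    next
      case False
      then obtain v where v: "ascent_step k w v" "v \<in> signed_perms k" "inversions k v \<subseteq> I"
        using ascent_step_within_biclosed[OF assms(1) less.prems(1) I] less.prems(2) by blast
      then have "inversion_number k v = inversion_number k w + 1" by (auto simp: ascent_step_def)
      then have "card (increasing_pairs k) - inversion_number k v <
          card (increasing_pairs k) - inversion_number k w"
        using inversion_number_le[of k v] by linarith
      then show ?thesis using less.hyps v by (meson converse_rtranclp_into_rtranclp)
    qed
  qed
  then show thesis using that by blast
qed

section \<open>Length as inversion number\<close>

lemma foldr_comp: "foldr (\<circ>) fs g = foldr (\<circ>) fs id \<circ> g"
  by (induction fs) (auto simp: comp_assoc)

text \<open>Each letter raises the inversion number by at most one, which bounds word lengths from
  below.\<close>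

lemma inversion_number_foldr_le:
  assumes "k > 0" "set ss \<subseteq> simple_gens k"
  shows "foldr (\<circ>) ss id \<in> signed_perms k \<and> inversion_number k (foldr (\<circ>) ss id) \<le> length ss"
  using assms(2)
proof (induction ss rule: rev_induct)
  case Nil
  have "inversion_number k id = 0" by (simp add: inversion_number_def)
  moreover have "foldr (\<circ>) [] (id :: int \<Rightarrow> int) = id" by simp
  ultimately show ?case using id_in_signed_perms[of k] by (metis le0)
next
  case (snoc s ss)
  let ?w = "foldr (\<circ>) ss id"
  have "set ss \<subseteq> simple_gens k" and s: "s \<in> simple_gens k" using snoc.prems by auto
  then have w: "?w \<in> signed_perms k" "inversion_number k ?w \<le> length ss" using snoc.IH by blast+
  have "foldr (\<circ>) (ss @ [s]) id = ?w \<circ> s" using foldr_comp[of ss s] by simp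
  moreover have "inversion_number k (?w \<circ> s) \<le> length ss + 1"
    by (rule simple_gens_ascent_or_descent[OF assms(1) w(1) s]) (use w(2) in auto)
  ultimately show ?case
    using comp_in_signed_perms[OF w(1) simple_gens_signed_perms[OF assms(1) s]]
    by (metis length_append_singleton Suc_eq_plus1)
qed

text \<open>A chain of ascents spells a word that attains this bound when it starts at
  \<open>id\<close>.\<close>

lemma ascent_steps_word:
  assumes "(ascent_step k)\<^sup>*\<^sup>* u v"
  shows "\<exists>ss. set ss \<subseteq> simple_gens k \<and> v = u \<circ> foldr (\<circ>) ss id \<and>
    inversion_number k v = inversion_number k u + length ss"
  using assms
proof (induction rule: rtranclp_induct)
  case base
  then show ?case by (intro exI[of _ "[]"]) auto
next
  case (step v w)
  then obtain ss where ss: "set ss \<subseteq> simple_gens k" "v = u \<circ> foldr (\<circ>) ss id"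
    "inversion_number k v = inversion_number k u + length ss" by blast
  obtain s where s: "s \<in> simple_gens k" "w = v \<circ> s"
    "inversion_number k w = inversion_number k v + 1"
    using step.hyps(2) unfolding ascent_step_def by blast
  have "w = u \<circ> foldr (\<circ>) (ss @ [s]) id"
    using foldr_comp[of ss s] unfolding s(2) ss(2) by (simp add: comp_assoc)
  moreover have "set (ss @ [s]) \<subseteq> simple_gens k" using ss(1) s(1) by simp
  moreover have "inversion_number k w = inversion_number k u + length (ss @ [s])" using ss(3) s(3) by simp
  ultimately show ?case by blast
qed

lemma length_B_eq_inversion_number:
  assumes "k > 0" and w: "w \<in> signed_perms k"
  shows "length_B k w = inversion_number k w"
  unfolding length_B_def
proof (rule Least_equality)
  obtain v where v: "v \<in> signed_perms k" "inversions k v = inversions k w" "(ascent_step k)\<^sup>*\<^sup>* id v"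
    using biclosed_reachable[OF assms(1) id_in_signed_perms biclosed_inversions[OF w]]
    by (metis empty_subsetI inversions_id)
  moreover have "v = w" using inversions_inject v w by blast
  moreover have "inversion_number k id = 0" using inversions_id[of k] by (simp add: inversion_number_def)
  ultimately show "\<exists>ss. length ss = inversion_number k w \<and> set ss \<subseteq> simple_gens k \<and> w = foldr (\<circ>) ss id"
    using ascent_steps_word[of k id w] by auto
next
  fix r assume "\<exists>ss. length ss = r \<and> set ss \<subseteq> simple_gens k \<and> w = foldr (\<circ>) ss id"
  then show "inversion_number k w \<le> r" using inversion_number_foldr_le[OF assms(1)] by blast
qed

text \<open>An increase of length rules out the descent alternative, and the ascent alternative
  supplies the inclusion of inversion sets.\<close>

lemma weak_cover_iff_ascent_step:
  assumes "k > 0"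
  shows "weak_cover k u v \<longleftrightarrow> ascent_step k u v"
proof -
  have "length_B k (u \<circ> s) = length_B k u + 1 \<longleftrightarrow>
      inversions k u \<subseteq> inversions k (u \<circ> s) \<and> inversion_number k (u \<circ> s) = inversion_number k u + 1"
    if "u \<in> signed_perms k" "s \<in> simple_gens k" for s
    using length_B_eq_inversion_number[OF assms] that
      comp_in_signed_perms[OF that(1) simple_gens_signed_perms[OF assms that(2)]]
    by (auto intro: simple_gens_ascent_or_descent[OF assms that])
  then show ?thesis by (auto simp: weak_cover_def ascent_step_def)
qed

text \<open>Covers enlarge the inversion set. Conversely, \<open>biclosed_reachable\<close> climbs
  from \<open>u\<close> to a permutation with the inversions of \<open>v\<close>, which is
  \<open>v\<close> by injectivity.\<close>

lemma weak_le_iff_inversions_subset: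
  assumes "k > 0" and u: "u \<in> signed_perms k" and v: "v \<in> signed_perms k"
  shows "weak_le k u v \<longleftrightarrow> inversions k u \<subseteq> inversions k v"
proof -
  have "weak_le k = (ascent_step k)\<^sup>*\<^sup>*"
    unfolding weak_le_def
    by (rule arg_cong[of _ _ rtranclp]) (intro ext weak_cover_iff_ascent_step[OF assms(1)])
  moreover have "inversions k u \<subseteq> inversions k v" if "(ascent_step k)\<^sup>*\<^sup>* u v"
    using that by induction (auto simp: ascent_step_def)
  moreover have "(ascent_step k)\<^sup>*\<^sup>* u v" if "inversions k u \<subseteq> inversions k v"
  proof -
    have "inversions k u \<subseteq> inversions k v" by (fact that)
    then obtain v' where "v' \<in> signed_perms k" "inversions k v' = inversions k v" "(ascent_step k)\<^sup>*\<^sup>* u v'"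
      by (rule biclosed_reachable[OF assms(1) u biclosed_inversions[OF v]])
    then show ?thesis using inversions_inject[OF _ v] by blast
  qed
  ultimately show ?thesis by auto
qed

lemma biclosed_iff_inversions:
  assumes "k > 0"
  shows "biclosed k I \<longleftrightarrow> (\<exists>w\<in>signed_perms k. inversions k w = I)"
proof
  assume I: "biclosed k I"
  have "inversions k id \<subseteq> I" by (simp only: inversions_id empty_subsetI)
  then show "\<exists>w\<in>signed_perms k. inversions k w = I"
    by (rule biclosed_reachable[OF assms id_in_signed_perms I]) blast
qed (use biclosed_inversions in blast)

subsection \<open>Joins and complements of biclosed sets\<close>

text \<open>Complementation exchanges transitivity with cotransitivity and respects the
  symmetry.\<close>

lemma biclosed_complement: "biclosed k I \<Longrightarrow> biclosed k (increasing_pairs k - I)"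
  using biclosed_uminus_iff[of k I]
  by (simp add: biclosed_def increasing_pairs_def) (meson order_less_trans)

text \<open>For cotransitivity, follow an increasing chain from \<open>a\<close> to
  \<open>c\<close>: either \<open>b\<close> is a vertex of it, or a single step jumps over
  \<open>b\<close>. Cotransitivity of \<open>I\<close> or \<open>J\<close> splits that step.\<close>

lemma biclosed_trancl_Un:
  assumes I: "biclosed k I" and J: "biclosed k J"
  shows "biclosed k ((I \<union> J)\<^sup>+)"
proof -
  have inc: "(I \<union> J)\<^sup>+ \<subseteq> increasing_pairs k"
  proof (rule trancl_mono_subset[THEN subset_trans])
    show "I \<union> J \<subseteq> increasing_pairs k" using I J biclosed_subset by blast
    show "(increasing_pairs k)\<^sup>+ \<subseteq> increasing_pairs k"
      by (subst trancl_id) (auto simp: trans_def increasing_pairs_def)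
  qed
  have "(- b, - a) \<in> (I \<union> J)\<^sup>+" if "(a, b) \<in> (I \<union> J)\<^sup>+" for a b
    using that
  proof induction
    case (base b)
    then show ?case using biclosed_uminus[OF I] biclosed_uminus[OF J] by blast
  next
    case (step b c)
    then have "(- c, - b) \<in> I \<union> J" using biclosed_uminus[OF I] biclosed_uminus[OF J] by blast
    then show ?case using step by (meson trancl_into_trancl2)
  qed
  moreover have "(a, b) \<in> (I \<union> J)\<^sup>+ \<or> (b, c) \<in> (I \<union> J)\<^sup>+"
    if "(a, c) \<in> (I \<union> J)\<^sup>+" "b \<in> pm_interval k" "a < b" "b < c" for a b c
  proof -
    have one: "(x, b) \<in> I \<union> J \<or> (b, y) \<in> I \<union> J" if "(x, y) \<in> I \<union> J" "x < b" "b < y" for x y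
      using biclosed_cotrans[OF I] biclosed_cotrans[OF J] that \<open>b \<in> pm_interval k\<close> by blast
    show ?thesis using that(1,4)
    proof induction
      case (base c)
      then show ?case using one \<open>a < b\<close> by blast
    next
      case (step y c)
      consider "b < y" | "b = y" | "y < b" by linarith
      then show ?case
      proof cases
        case 1
        then show ?thesis using step by (meson trancl_into_trancl)
      next
        case 2
        then show ?thesis using step by blast
      next
        case 3
        then show ?thesis using one[OF step.hyps(2) 3 step.prems] step.hyps(1)
          by (meson trancl_into_trancl r_into_trancl)
      qed
    qed
  qed
  ultimately show ?thesis using inc unfolding biclosed_def by (meson trancl_trans)
qed

subsection \<open>Blocks of signed Wachs permutations\<close>

text \<open>Both branches round \<open>a / 2\<close> away from zero, so \<open>2 * i - 1\<close> and
  \<open>2 * i\<close> get label \<open>i\<close> and their negatives get label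
  \<open>- i\<close>.\<close>

definition block :: "int \<Rightarrow> int" where
  "block a = (if 0 < a then (a + 1) div 2 else a div 2)"

text \<open>The odd element is the representative because for odd \<open>n\<close> the last block is \<open>{n}\<close>.\<close>

definition block_rep :: "int \<Rightarrow> int" where
  "block_rep c = (if 0 < c then 2 * c - 1 else 2 * c + 1)"

lemma block_pos_cases: "0 < a \<Longrightarrow> 0 < block a \<and> (a = 2 * block a - 1 \<or> a = 2 * block a)"
  unfolding block_def by presburger

lemma block_neg_cases: "a < 0 \<Longrightarrow> block a < 0 \<and> (a = 2 * block a \<or> a = 2 * block a + 1)"
  unfolding block_def by presburger

lemma block_zero [simp]: "block 0 = 0"
  by (simp add: block_def)

lemma block_eq_0_iff [simp]: "block a = 0 \<longleftrightarrow> a = 0"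
  using block_pos_cases[of a] block_neg_cases[of a] by (cases a "0 :: int" rule: linorder_cases) auto

lemma block_uminus: "block (- a) = - block a"
proof (cases a "0 :: int" rule: linorder_cases)
  case less
  then show ?thesis using block_pos_cases[of "- a"] block_neg_cases[of a] by presburger
next
  case greater
  then show ?thesis using block_pos_cases[of a] block_neg_cases[of "- a"] by presburger
qed simp

lemma block_mono:
  assumes "a \<le> b"
  shows "block a \<le> block b"
proof -
  consider "0 < a" | "a \<le> 0" "0 < b" | "b \<le> 0" using assms by linarith
  then show ?thesis
    by cases (use assms in \<open>auto simp: block_def intro: zdiv_mono1\<close>)
qed

lemma block_less_iff: "block a \<noteq> block b \<Longrightarrow> block a < block b \<longleftrightarrow> a < b"
  using block_mono[of a b] block_mono[of b a] by linarith

lemma block_in: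
  assumes "a \<in> pm_interval n"
  shows "block a \<in> pm_interval ((n + 1) div 2)"
proof -
  have "2 * \<bar>block a\<bar> \<le> \<bar>a\<bar> + 1"
    using block_pos_cases[of a] block_neg_cases[of a] by (cases a "0 :: int" rule: linorder_cases) auto
  then have "2 * \<bar>block a\<bar> \<le> int n + 1" using assms by (simp add: pm_interval_iff)
  then have "\<bar>block a\<bar> \<le> int ((n + 1) div 2)" by linarith
  then show ?thesis using assms by (simp add: pm_interval_iff)
qed

lemma block_eqE:
  assumes "block a = block b" "a < b" "a \<noteq> 0" "b \<noteq> 0"
  obtains "0 < block a" "a = 2 * block a - 1" "b = 2 * block a"
    | "block a < 0" "a = 2 * block a" "b = 2 * block a + 1"
proof (cases "0 < a")
  case True
  then have "0 < block a" "a = 2 * block a - 1 \<and> b = 2 * block a"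
    using assms block_pos_cases[of a] block_pos_cases[of b] by auto
  then show thesis using that(1) by blast
next
  case False
  then have "block a < 0" using assms block_neg_cases[of a] by auto
  moreover from this have "b < 0" using assms block_pos_cases[of b] by (cases "0 < b") auto
  then have "a = 2 * block a \<and> b = 2 * block a + 1"
    using False assms block_neg_cases[of a] block_neg_cases[of b] by auto
  ultimately show thesis using that(2) by blast
qed

text \<open>Blocks have at most two elements, so transitivity arguments with three values never stay
  inside one block.\<close>

lemma block_no_three:
  assumes "a < b" "b < c" "a \<noteq> 0" "b \<noteq> 0" "c \<noteq> 0"
  shows "block a < block c"
proof (rule ccontr)
  assume "\<not> block a < block c"
  then have eq: "block a = block b" "block b = block c"
    using block_mono[of a b] block_mono[of b c] assms by linarith+
  from eq(1) \<open>a < b\<close> \<open>a \<noteq> 0\<close> \<open>b \<noteq> 0\<close>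
  have "b = 2 * block a \<and> 0 < block a \<or> b = 2 * block a + 1 \<and> block a < 0"
    by (cases rule: block_eqE) blast+
  then have "b = 2 * block b \<and> 0 < block b \<or> b = 2 * block b + 1 \<and> block b < 0" unfolding eq(1) .
  moreover from eq(2) \<open>b < c\<close> \<open>b \<noteq> 0\<close> \<open>c \<noteq> 0\<close>
  have "b = 2 * block b - 1 \<and> 0 < block b \<or> b = 2 * block b \<and> block b < 0"
    by (cases rule: block_eqE) blast+
  ultimately show False by linarith
qed

lemma block_pair: "0 < i \<Longrightarrow> block (2 * i - 1) = i" "0 < i \<Longrightarrow> block (2 * i) = i"
  by (simp_all add: block_def)

lemma block_rep_uminus: "c \<noteq> 0 \<Longrightarrow> block_rep (- c) = - block_rep c"
  by (simp add: block_rep_def)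

lemma block_block_rep: "c \<noteq> 0 \<Longrightarrow> block (block_rep c) = c"
  using block_pair(1)[of c] by (auto simp: block_rep_def) (simp add: block_def)

lemma block_rep_less_iff: "c \<noteq> 0 \<Longrightarrow> d \<noteq> 0 \<Longrightarrow> block_rep c < block_rep d \<longleftrightarrow> c < d"
  by (auto simp: block_rep_def)

lemma block_rep_in:
  assumes "c \<in> pm_interval ((n + 1) div 2)"
  shows "block_rep c \<in> pm_interval n"
proof -
  have "c \<noteq> 0" "2 * \<bar>c\<bar> \<le> int n + 1" using assms by (auto simp: pm_interval_iff)
  then show ?thesis by (auto simp: block_rep_def pm_interval_iff)
qed

section \<open>Characterisations of signed Wachs permutations by blocks\<close>

lemma signed_wachs_iff_pairs:
  "v \<in> signed_wachs n \<longleftrightarrow>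
     v \<in> signed_perms n \<and> (\<forall>i\<in>{1..n div 2}. \<bar>inv v (2 * int i - 1) - inv v (2 * int i)\<bar> \<le> 1)"
proof -
  have "(\<forall>a\<in>{1..n - 1}. \<bar>inv v (int a) - inv v (int (star n a))\<bar> \<le> 1) \<longleftrightarrow>
      (\<forall>i\<in>{1..n div 2}. \<bar>inv v (2 * int i - 1) - inv v (2 * int i)\<bar> \<le> 1)" (is "?L \<longleftrightarrow> ?R")
  proof
    assume L: ?L
    show ?R
    proof
      fix i assume i: "i \<in> {1..n div 2}"
      then have "2 * i - 1 \<in> {1..n - 1}" "star n (2 * i - 1) = 2 * i" by (auto simp: star_def)
      then have "\<bar>inv v (int (2 * i - 1)) - inv v (int (2 * i))\<bar> \<le> 1" using L by metis
      then show "\<bar>inv v (2 * int i - 1) - inv v (2 * int i)\<bar> \<le> 1" using i by (simp add: of_nat_diff)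
    qed
  next
    assume R: ?R
    show ?L
    proof
      \<comment> \<open>The conditions at the two members of a pair agree by symmetry of the
        absolute value. As \<open>a < n\<close>, the pair containing \<open>a\<close> lies within 1
        to \<open>n\<close>.\<close>
      fix a assume a: "a \<in> {1..n - 1}"
      show "\<bar>inv v (int a) - inv v (int (star n a))\<bar> \<le> 1"
      proof (cases "even a")
        case True
        then obtain i where "a = 2 * i" by blast
        then show ?thesis using a R[rule_format, of i] by (auto simp: star_def of_nat_diff abs_minus_commute)
      next
        case False
        then obtain j where "a = 2 * j + 1" using oddE by blast
        then show ?thesis using a R[rule_format, of "j + 1"] by (auto simp: star_def add.commute)
      qed
    qed
  qed
  then show ?thesis by (simp add: signed_wachs_def)
qed

lemma signed_wachs_signed_perms: "v \<in> signed_wachs n \<Longrightarrow> v \<in> signed_perms n"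
  by (simp add: signed_wachs_def)

text \<open>The defining condition concerns positive values; oddness of \<open>inv v\<close> carries
  it to the negative blocks.\<close>

lemma signed_wachs_block_close:
  assumes v: "v \<in> signed_wachs n" and "a \<in> pm_interval n" "b \<in> pm_interval n" "block a = block b"
  shows "\<bar>inv v a - inv v b\<bar> \<le> 1"
proof -
  have vB: "v \<in> signed_perms n" using v by (rule signed_wachs_signed_perms)
  have less: "\<bar>inv v a - inv v b\<bar> \<le> 1"
    if "a \<in> pm_interval n" "b \<in> pm_interval n" "block a = block b" "a < b" for a b
  proof -
    define i where "i = nat \<bar>block a\<bar>"
    have "a \<noteq> 0" "b \<noteq> 0" "\<bar>a\<bar> \<le> int n" "\<bar>b\<bar> \<le> int n" using that by (auto simp: pm_interval_iff)
    from that(3,4) this(1,2) show ?thesis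
    proof (cases rule: block_eqE)
      case 1
      then have "i \<in> {1..n div 2}" "int i = block a" using \<open>\<bar>b\<bar> \<le> int n\<close> by (auto simp: i_def)
      moreover have "\<bar>inv v (2 * int i - 1) - inv v (2 * int i)\<bar> \<le> 1"
        using v \<open>i \<in> {1..n div 2}\<close> by (auto simp: signed_wachs_iff_pairs)
      ultimately show ?thesis using 1 by metis
    next
      case 2
      then have i: "i \<in> {1..n div 2}" "int i = - block a" using \<open>\<bar>a\<bar> \<le> int n\<close> by (auto simp: i_def)
      then have "a = - (2 * int i)" "b = - (2 * int i - 1)" using 2 by auto
      moreover have "\<bar>inv v (2 * int i - 1) - inv v (2 * int i)\<bar> \<le> 1"
        using v i(1) by (auto simp: signed_wachs_iff_pairs)
      ultimately show ?thesis by (simp only: signed_perms_inv_uminus[OF vB])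
    qed
  qed
  show ?thesis using less[of a b] less[of b a] assms by (cases a b rule: linorder_cases) auto
qed

text \<open>Positions at distance at most 1 leave no room for a value of another block. Conversely,
  if no foreign value can separate a block, its two positions are consecutive.\<close>

lemma signed_wachs_iff_blocks:
  assumes v: "v \<in> signed_perms n"
  shows "v \<in> signed_wachs n \<longleftrightarrow>
    (\<forall>a\<in>pm_interval n. \<forall>a'\<in>pm_interval n. \<forall>b\<in>pm_interval n.
       block a = block a' \<longrightarrow> block b \<noteq> block a \<longrightarrow> (inv v a < inv v b \<longleftrightarrow> inv v a' < inv v b))"
    (is "_ \<longleftrightarrow> ?R")
proof
  assume W: "v \<in> signed_wachs n"
  have "inv v a < inv v b \<longleftrightarrow> inv v a' < inv v b"
    if "a \<in> pm_interval n" "a' \<in> pm_interval n" "b \<in> pm_interval n" "block a = block a'" "block b \<noteq> block a"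
    for a a' b
  proof -
    have "a \<noteq> b" "a' \<noteq> b" using that by auto
    then have "inv v a \<noteq> inv v b" "inv v a' \<noteq> inv v b" by (simp_all add: signed_perms_inv_eq_iff[OF v])
    with signed_wachs_block_close[OF W that(1,2,4)] show ?thesis by linarith
  qed
  then show ?R by blast
next
  assume R: ?R
  have "\<bar>inv v (2 * int i - 1) - inv v (2 * int i)\<bar> \<le> 1" if i: "i \<in> {1..n div 2}" for i
  proof -
    let ?a = "2 * int i - 1" and ?b = "2 * int i"
    have ab: "?a \<in> pm_interval n" "?b \<in> pm_interval n" "block ?a = int i" "block ?b = int i"
      using i block_pair[of "int i"] by (auto simp: pm_interval_iff)
    have pos: "inv v ?a \<in> pm_interval n" "inv v ?b \<in> pm_interval n"
      using ab by (simp_all add: signed_perms_inv_in_iff[OF v])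
    have neq: "inv v ?a \<noteq> inv v ?b" "inv v ?a \<noteq> - inv v ?b"
      using i by (auto simp: signed_perms_inv_eq_iff[OF v] signed_perms_inv_uminus[OF v, symmetric])
    \<comment> \<open>A value strictly between would belong to another block, yet compare
      differently with the two block members.\<close>
    have between: "\<not> (inv v x < q \<and> q < inv v y)"
      if xy: "{x, y} = {?a, ?b}" and q: "q \<in> pm_interval n" for x y q
    proof
      assume lt: "inv v x < q \<and> q < inv v y"
      have c: "v q \<in> pm_interval n" using q by (simp add: signed_perms_in_iff[OF v])
      have ic: "inv v (v q) = q" using v by simp
      then have "v q \<noteq> ?a" "v q \<noteq> ?b" using lt xy by (auto simp: doubleton_eq_iff)
      moreover have "v q \<noteq> 0" "?a \<noteq> 0" "?b \<noteq> 0" using c i by (auto simp: pm_interval_iff)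
      ultimately have "block (v q) \<noteq> int i"
        using block_no_three[of ?a ?b "v q"] block_no_three[of "v q" ?a ?b] ab(3,4)
        by (cases "v q" ?a rule: linorder_cases) auto
      then have "inv v x < q \<longleftrightarrow> inv v y < q"
        using R[rule_format, of x y "v q"] xy ab c ic by (auto simp: doubleton_eq_iff)
      then show False using lt by auto
    qed
    have close: "\<bar>inv v x - inv v y\<bar> \<le> 1" if xy: "{x, y} = {?a, ?b}" and "inv v x < inv v y" for x y
    proof -
      have "consecutive n (inv v x) (inv v y)"
        using between[OF xy] that pos by (auto simp: consecutive_def doubleton_eq_iff)
      then show ?thesis
        \<comment> \<open>The neighbouring positions \<open>-1\<close> and \<open>1\<close> are at distance 2, but carry opposite values.\<close>
        by (cases rule: consecutive_cases) (use neq xy in \<open>auto simp: doubleton_eq_iff\<close>)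
    qed
    show ?thesis using close[of ?a ?b] close[of ?b ?a] neq(1)
      by (cases "inv v ?a" "inv v ?b" rule: linorder_cases) (auto simp: insert_commute)
  qed
  then show "v \<in> signed_wachs n" using v by (simp add: signed_wachs_iff_pairs)
qed

section \<open>Passing between inversion sets and block data\<close>

definition block_pairs :: "nat \<Rightarrow> (int \<times> int) set \<Rightarrow> (int \<times> int) set" where
  "block_pairs n I = {(c, d) \<in> increasing_pairs ((n + 1) div 2). (block_rep c, block_rep d) \<in> I}"

text \<open>Positive blocks suffice by symmetry. For odd \<open>n\<close> the last block
  \<open>{n}\<close> has no internal pair, whence the bound \<open>n div 2\<close>.\<close>

definition flipped_blocks :: "nat \<Rightarrow> (int \<times> int) set \<Rightarrow> nat set" where
  "flipped_blocks n I = {i \<in> {1..n div 2}. (2 * int i - 1, 2 * int i) \<in> I}"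

text \<open>Rebuilds a set of pairs from block data. The absolute value gives a block and its mirror
  the same internal order flag, as the symmetry demands.\<close>

definition inflate :: "nat \<Rightarrow> (int \<times> int) set \<Rightarrow> nat set \<Rightarrow> (int \<times> int) set" where
  "inflate n J X = {(a, b) \<in> increasing_pairs n.
     if block a = block b then nat \<bar>block a\<bar> \<in> X else (block a, block b) \<in> J}"

text \<open>Pulling back along the strictly increasing odd map \<open>block_rep\<close> preserves
  every clause.\<close>

lemma biclosed_block_pairs:
  assumes I: "biclosed n I"
  shows "biclosed ((n + 1) div 2) (block_pairs n I)"
proof -
  have nz: "c \<noteq> 0" if "c \<in> pm_interval ((n + 1) div 2)" for c using that by (simp add: pm_interval_iff)
  show ?thesis
    unfolding biclosed_def
  proof (intro conjI allI impI)
    show "block_pairs n I \<subseteq> increasing_pairs ((n + 1) div 2)" by (auto simp: block_pairs_def)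
  next
    fix a b assume "(a, b) \<in> block_pairs n I"
    then show "(- b, - a) \<in> block_pairs n I"
      using nz by (auto simp: block_pairs_def increasing_pairs_def block_rep_uminus biclosed_uminus_iff[OF I])
  next
    fix a b c assume "(a, b) \<in> block_pairs n I" "(b, c) \<in> block_pairs n I"
    then show "(a, c) \<in> block_pairs n I"
      using biclosed_trans[OF I] by (auto simp: block_pairs_def increasing_pairs_def)
  next
    fix a b c assume "(a, c) \<in> block_pairs n I" "b \<in> pm_interval ((n + 1) div 2)" "a < b" "b < c"
    then show "(a, b) \<in> block_pairs n I \<or> (b, c) \<in> block_pairs n I"
      using biclosed_cotrans[OF I, of "block_rep a" "block_rep c" "block_rep b"] block_rep_in[of b n]
        block_rep_less_iff nz
      by (auto simp: block_pairs_def increasing_pairs_def)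
  qed
qed

text \<open>Among three increasing values the outer two lie in different blocks. If the middle one
  shares a block with either, a single pair of blocks decides; otherwise the property of
  \<open>J\<close> applies.\<close>

lemma biclosed_inflate:
  assumes J: "biclosed ((n + 1) div 2) J"
  shows "biclosed n (inflate n J X)"
proof -
  have nz: "c \<noteq> 0" if "c \<in> pm_interval n" for c using that by (simp add: pm_interval_iff)
  show ?thesis
    unfolding biclosed_def
  proof (intro conjI allI impI)
    show "inflate n J X \<subseteq> increasing_pairs n" by (auto simp: inflate_def)
  next
    fix a b assume "(a, b) \<in> inflate n J X"
    then show "(- b, - a) \<in> inflate n J X"
      by (auto simp: inflate_def increasing_pairs_def block_uminus biclosed_uminus_iff[OF J] split: if_splits)
  next
    fix a b c assume ab: "(a, b) \<in> inflate n J X" and bc: "(b, c) \<in> inflate n J X"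
    then have "block a < block c" 
      using block_no_three[of a b c] nz by (auto simp: inflate_def increasing_pairs_def)
    then show "(a, c) \<in> inflate n J X"
      using ab bc biclosed_trans[OF J, of "block a" "block b" "block c"]
      by (auto simp: inflate_def increasing_pairs_def split: if_splits)
  next
    fix a b c assume ac: "(a, c) \<in> inflate n J X" and b: "b \<in> pm_interval n" "a < b" "b < c"
    then have "block a < block c"
      using block_no_three[of a b c] nz by (auto simp: inflate_def increasing_pairs_def)
    moreover have "block a \<le> block b" "block b \<le> block c" using b block_mono by auto
    ultimately show "(a, b) \<in> inflate n J X \<or> (b, c) \<in> inflate n J X"
      using ac b block_in[OF b(1)] biclosed_cotrans[OF J, of "block a" "block c" "block b"]
      by (auto simp: inflate_def increasing_pairs_def split: if_splits)
  qed
qed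

lemma block_pairs_inflate:
  assumes "J \<subseteq> increasing_pairs ((n + 1) div 2)"
  shows "block_pairs n (inflate n J X) = J"
proof -
  have "(block_rep c, block_rep d) \<in> inflate n J X \<longleftrightarrow> (c, d) \<in> J"
    if cd: "(c, d) \<in> increasing_pairs ((n + 1) div 2)" for c d
  proof -
    have "c \<noteq> 0" "d \<noteq> 0" using cd by (auto simp: increasing_pairs_def pm_interval_iff)
    then show ?thesis using cd block_rep_in[of _ n]
      by (auto simp: inflate_def increasing_pairs_def block_block_rep block_rep_less_iff)
  qed
  then show ?thesis using assms by (auto simp: block_pairs_def)
qed

lemma flipped_blocks_inflate:
  assumes "X \<subseteq> {1..n div 2}"
  shows "flipped_blocks n (inflate n J X) = X"
proof -
  have "(2 * int i - 1, 2 * int i) \<in> inflate n J X \<longleftrightarrow> i \<in> X" if "i \<in> {1..n div 2}" for i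
    using that block_pair[of "int i"] by (auto simp: inflate_def increasing_pairs_def pm_interval_iff)
  then show ?thesis using assms by (auto simp: flipped_blocks_def)
qed

lemma inflate_mono: "J \<subseteq> J' \<Longrightarrow> X \<subseteq> X' \<Longrightarrow> inflate n J X \<subseteq> inflate n J' X'"
  by (auto simp: inflate_def)

text \<open>Inside a block the symmetry reduces to positive values. Across blocks, values may be
  replaced by the representatives of their blocks.\<close>

lemma signed_wachs_inversions_eq_inflate:
  assumes W: "v \<in> signed_wachs n"
  defines "I \<equiv> inversions n v"
  shows "I = inflate n (block_pairs n I) (flipped_blocks n I)"
proof -
  have v: "v \<in> signed_perms n" using W by (rule signed_wachs_signed_perms)
  have I: "biclosed n I" unfolding I_def using v by (rule biclosed_inversions)
  have "(a, b) \<in> I \<longleftrightarrow> (a, b) \<in> inflate n (block_pairs n I) (flipped_blocks n I)"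
    if inc: "(a, b) \<in> increasing_pairs n" for a b
  proof -
    have ab: "a \<in> pm_interval n" "b \<in> pm_interval n" "a < b" and nz: "a \<noteq> 0" "b \<noteq> 0"
      and le: "\<bar>a\<bar> \<le> int n" "\<bar>b\<bar> \<le> int n"
      using inc by (auto simp: increasing_pairs_def pm_interval_iff)
    show ?thesis
    proof (cases "block a = block b")
      case True
      define i where "i = nat \<bar>block a\<bar>"
      have "i \<in> {1..n div 2} \<and> ((a, b) \<in> I \<longleftrightarrow> (2 * int i - 1, 2 * int i) \<in> I)"
        using True ab(3) nz
      proof (cases rule: block_eqE)
        case 1
        then show ?thesis using le by (auto simp: i_def)
      next
        case 2
        then have "a = - (2 * int i)" "b = - (2 * int i - 1)" "1 \<le> i" by (auto simp: i_def)
        then show ?thesis using biclosed_uminus_iff[OF I, of "2 * int i" "2 * int i - 1"] le by auto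
      qed
      then show ?thesis using True inc by (auto simp: inflate_def flipped_blocks_def i_def)
    next
      case False
      then have lt: "block a < block b" using block_less_iff[of a b] ab by blast
      let ?a = "block_rep (block a)" and ?b = "block_rep (block b)"
      have blk: "block a \<in> pm_interval ((n + 1) div 2)" "block b \<in> pm_interval ((n + 1) div 2)"
        using ab block_in by auto
      then have bnz: "block a \<noteq> 0" "block b \<noteq> 0" by (auto simp: pm_interval_iff)
      have rep: "?a \<in> pm_interval n" "?b \<in> pm_interval n" using blk block_rep_in by auto
      have "?a < ?b" using lt bnz by (simp add: block_rep_less_iff)
      have wachs: "inv v x < inv v z \<longleftrightarrow> inv v y < inv v z"
        if "x \<in> pm_interval n" "y \<in> pm_interval n" "z \<in> pm_interval n" "block x = block y" "block z \<noteq> block x"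
        for x y z
        using W that unfolding signed_wachs_iff_blocks[OF v] by blast
      \<comment> \<open>The two values are replaced one at a time, since the Wachs condition
        compares a whole block with one fixed outside value.\<close>
      have "inv v b < inv v a \<longleftrightarrow> inv v ?b < inv v a"
        using wachs[of b ?b a] ab rep False bnz by (simp add: block_block_rep)
      also have "\<dots> \<longleftrightarrow> \<not> inv v a < inv v ?b"
        using signed_perms_inv_eq_iff[OF v, of a ?b] False bnz block_block_rep[of "block b"] by force
      also have "\<dots> \<longleftrightarrow> \<not> inv v ?a < inv v ?b"
        using wachs[of a ?a ?b] ab rep False bnz by (simp add: block_block_rep)
      also have "\<dots> \<longleftrightarrow> inv v ?b < inv v ?a"
        using signed_perms_inv_eq_iff[OF v, of ?a ?b] \<open>?a < ?b\<close> by force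
      finally show ?thesis
        using inc lt blk rep \<open>?a < ?b\<close> False
        by (simp add: I_def inflate_def block_pairs_def inversions_def increasing_pairs_def)
    qed
  qed
  moreover have "I \<subseteq> increasing_pairs n" using biclosed_subset[OF I] .
  moreover have "inflate n (block_pairs n I) (flipped_blocks n I) \<subseteq> increasing_pairs n"
    by (auto simp: inflate_def)
  ultimately show ?thesis by (intro subset_antisym subrelI) (meson subsetD)+
qed

text \<open>Across blocks, membership in \<open>inflate n J X\<close> sees only labels, so the
  criterion \<open>signed_wachs_iff_blocks\<close> applies.\<close>

lemma signed_wachs_if_inversions_inflate:
  assumes v: "v \<in> signed_perms n" and eq: "inversions n v = inflate n J X"
  shows "v \<in> signed_wachs n"
  unfolding signed_wachs_iff_blocks[OF v]
proof (intro ballI impI)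
  fix a a' b assume *: "a \<in> pm_interval n" "a' \<in> pm_interval n" "b \<in> pm_interval n"
    "block a = block a'" "block b \<noteq> block a"
  have "before (inflate n J X) a b \<longleftrightarrow> before (inflate n J X) a' b"
    using * block_less_iff[of a b] block_less_iff[of a' b] block_less_iff[of b a] block_less_iff[of b a']
    by (auto simp: before_def inflate_def increasing_pairs_def)
  then show "inv v a < inv v b \<longleftrightarrow> inv v a' < inv v b"
    using before_inversions[OF v] * eq by simp
qed

text \<open>The first component stays a biclosed set instead of a signed permutation, so that the
  order becomes componentwise inclusion.\<close>

definition wachs_decomposition :: "nat \<Rightarrow> (int \<Rightarrow> int) \<Rightarrow> (int \<times> int) set \<times> nat set" where
  "wachs_decomposition n v = (block_pairs n (inversions n v), flipped_blocks n (inversions n v))"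

lemma wachs_decomposition_in:
  "v \<in> signed_wachs n \<Longrightarrow>
     wachs_decomposition n v \<in> {J. biclosed ((n + 1) div 2) J} \<times> Pow {1..n div 2}"
  using biclosed_block_pairs[OF biclosed_inversions[OF signed_wachs_signed_perms[of v n]]]
  by (auto simp: wachs_decomposition_def flipped_blocks_def)

lemma wachs_decomposition_surj:
  assumes "n > 0" and J: "biclosed ((n + 1) div 2) J" and X: "X \<subseteq> {1..n div 2}"
  obtains v where "v \<in> signed_wachs n" "wachs_decomposition n v = (J, X)"
proof -
  obtain v where v: "v \<in> signed_perms n" "inversions n v = inflate n J X"
    using biclosed_inflate[OF J] biclosed_iff_inversions[OF assms(1)] by blast
  then show thesis
    using that[of v] signed_wachs_if_inversions_inflate
      block_pairs_inflate[OF biclosed_subset[OF J]] flipped_blocks_inflate[OF X]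
    by (simp add: wachs_decomposition_def)
qed

text \<open>Extracting block data and inflating are both monotone, and on signed Wachs permutations
  inflating recovers the inversion set.\<close>

lemma weak_le_iff_wachs_decomposition:
  assumes "n > 0" and u: "u \<in> signed_wachs n" and v: "v \<in> signed_wachs n"
  shows "weak_le n u v \<longleftrightarrow>
    fst (wachs_decomposition n u) \<subseteq> fst (wachs_decomposition n v) \<and>
    snd (wachs_decomposition n u) \<subseteq> snd (wachs_decomposition n v)"
proof -
  have "weak_le n u v \<longleftrightarrow> inversions n u \<subseteq> inversions n v"
    using assms by (intro weak_le_iff_inversions_subset signed_wachs_signed_perms)
  moreover have "inversions n u \<subseteq> inversions n v"
    if "block_pairs n (inversions n u) \<subseteq> block_pairs n (inversions n v)"
      "flipped_blocks n (inversions n u) \<subseteq> flipped_blocks n (inversions n v)"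
    using inflate_mono[OF that, of n] signed_wachs_inversions_eq_inflate[OF u]
      signed_wachs_inversions_eq_inflate[OF v] by metis
  ultimately show ?thesis
    by (auto simp: wachs_decomposition_def block_pairs_def flipped_blocks_def)
qed

subsection \<open>The poset of signed Wachs permutations\<close>

text \<open>Everything is phrased by common bounds in the order, so that the hypotheses can be
  checked without computing with the chosen meet and join.\<close>

lemma complemented_bounded_latticeI:
  fixes L (structure)
  assumes "partial_order L"
    and bot: "b \<in> carrier L" "\<And>x. x \<in> carrier L \<Longrightarrow> b \<sqsubseteq> x"
    and top: "t \<in> carrier L" "\<And>x. x \<in> carrier L \<Longrightarrow> x \<sqsubseteq> t"
    and sup: "\<And>x y. x \<in> carrier L \<Longrightarrow> y \<in> carrier L \<Longrightarrow>
      \<exists>s\<in>carrier L. x \<sqsubseteq> s \<and> y \<sqsubseteq> s \<and> (\<forall>z\<in>carrier L. x \<sqsubseteq> z \<longrightarrow> y \<sqsubseteq> z \<longrightarrow> s \<sqsubseteq> z)"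
    and inf: "\<And>x y. x \<in> carrier L \<Longrightarrow> y \<in> carrier L \<Longrightarrow>
      \<exists>s\<in>carrier L. s \<sqsubseteq> x \<and> s \<sqsubseteq> y \<and> (\<forall>z\<in>carrier L. z \<sqsubseteq> x \<longrightarrow> z \<sqsubseteq> y \<longrightarrow> z \<sqsubseteq> s)"
    and compl: "\<And>x. x \<in> carrier L \<Longrightarrow>
      \<exists>y\<in>carrier L. (\<forall>z\<in>carrier L. z \<sqsubseteq> x \<longrightarrow> z \<sqsubseteq> y \<longrightarrow> z \<sqsubseteq> b) \<and>
        (\<forall>z\<in>carrier L. x \<sqsubseteq> z \<longrightarrow> y \<sqsubseteq> z \<longrightarrow> t \<sqsubseteq> z)"
  shows "complemented_bounded_lattice L"
proof -
  interpret partial_order L by fact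
  interpret bounded_lattice L
  proof
    fix x y assume xy: "x \<in> carrier L" "y \<in> carrier L"
    show "\<exists>s. least L s (Upper L {x, y})"
      using sup[OF xy] xy by (auto simp: least_def Upper_def)
    show "\<exists>s. greatest L s (Lower L {x, y})"
      using inf[OF xy] xy by (auto simp: greatest_def Lower_def)
  next
    show "\<exists>x. least L x (carrier L)" using bot by (auto simp: least_def)
    show "\<exists>x. greatest L x (carrier L)" using top by (auto simp: greatest_def)
  qed
  have b: "b = \<bottom>" using bot by (rule bottom_eq)
  have t: "t = \<top>" using top by (rule top_eq)
  show ?thesis
  proof
    fix x assume x: "x \<in> carrier L"
    then obtain y where y: "y \<in> carrier L"
      and y_meet: "\<And>z. z \<in> carrier L \<Longrightarrow> z \<sqsubseteq> x \<Longrightarrow> z \<sqsubseteq> y \<Longrightarrow> z \<sqsubseteq> b"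
      and y_join: "\<And>z. z \<in> carrier L \<Longrightarrow> x \<sqsubseteq> z \<Longrightarrow> y \<sqsubseteq> z \<Longrightarrow> t \<sqsubseteq> z"
      using compl[OF x] by blast
    have "x \<sqinter> y \<sqsubseteq> b" using x y by (intro y_meet) (auto intro: meet_left meet_right)
    moreover have "t \<sqsubseteq> x \<squnion> y" using x y by (intro y_join) (auto intro: join_left join_right)
    ultimately have "x \<sqinter> y = \<bottom> \<and> x \<squnion> y = \<top>"
      using x y bot top unfolding b[symmetric] t[symmetric]
      by (auto intro!: le_antisym meet_closed join_closed)
    then show "\<exists>y\<in>carrier L. x \<sqinter> y = \<bottom> \<and> x \<squnion> y = \<top>" using y by blast
  qed
qed

section \<open>The partial orders and the isomorphism\<close>

lemma partial_order_eqI: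
  assumes "\<And>x. x \<in> C \<Longrightarrow> R x x"
    and "\<And>x y. x \<in> C \<Longrightarrow> y \<in> C \<Longrightarrow> R x y \<Longrightarrow> R y x \<Longrightarrow> x = y"
    and "\<And>x y z. x \<in> C \<Longrightarrow> y \<in> C \<Longrightarrow> z \<in> C \<Longrightarrow> R x y \<Longrightarrow> R y z \<Longrightarrow> R x z"
  shows "partial_order \<lparr>carrier = C, eq = (=), le = R\<rparr>"
  by unfold_locales (simp_all add: assms(1,2), rule assms(3))

lemma partial_order_weak_le:
  assumes "k > 0" "C \<subseteq> signed_perms k"
  shows "partial_order \<lparr>carrier = C, eq = (=), le = weak_le k\<rparr>"
proof (rule partial_order_eqI)
  fix x y assume "x \<in> C" "y \<in> C" "weak_le k x y" "weak_le k y x"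
  then show "x = y"
    using assms weak_le_iff_inversions_subset[OF assms(1)] inversions_inject[of x k y]
    by (metis subsetD subset_antisym)
qed (auto simp: weak_le_def)

lemma partial_order_B_poset: "k > 0 \<Longrightarrow> partial_order (B_poset k)"
  by (simp add: B_poset_def partial_order_weak_le)

lemma partial_order_wachs_poset: "n > 0 \<Longrightarrow> partial_order (wachs_poset n)"
  unfolding wachs_poset_def
  by (rule partial_order_weak_le) (auto intro: signed_wachs_signed_perms)

lemma partial_order_powerset_poset: "partial_order (powerset_poset X)"
  unfolding powerset_poset_def by (rule partial_order_eqI) auto

lemma partial_order_prod_poset:
  assumes "partial_order P" "partial_order Q"
  shows "partial_order (prod_poset P Q)"
proof -
  interpret P: partial_order P by fact
  interpret Q: partial_order Q by fact
  show ?thesis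
    unfolding prod_poset_def
    by (rule partial_order_eqI)
      (auto intro: P.le_antisym Q.le_antisym P.le_trans Q.le_trans)
qed

lemma wachs_poset_isomorphic:
  assumes "n > 0"
  shows "poset_isomorphic (wachs_poset n)
    (prod_poset (B_poset ((n + 1) div 2)) (powerset_poset {1..n div 2}))"
proof -
  define m where "m = (n + 1) div 2"
  have m: "m > 0" using assms by (simp add: m_def)
  let ?Q = "prod_poset (B_poset m) (powerset_poset {1..n div 2})"
  \<comment> \<open>Turns a biclosed set of block pairs back into the signed permutation of blocks
    having it as inversion set.\<close>
  define perm where "perm = inv_into (signed_perms m) (inversions m)"
  have bij: "bij_betw (inversions m) (signed_perms m) {J. biclosed m J}"
    using biclosed_iff_inversions[OF m] inversions_inject by (auto simp: bij_betw_def inj_on_def)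
  have perm_in: "perm J \<in> signed_perms m" and inversions_perm: "inversions m (perm J) = J"
    if "biclosed m J" for J
    using that bij_betw_inv_into_right[OF bij] bij_betwE[OF bij_betw_inv_into[OF bij]]
    by (auto simp: perm_def)
  have perm_inversions: "perm (inversions m u) = u" if "u \<in> signed_perms m" for u
    using that bij_betw_inv_into_left[OF bij] by (simp add: perm_def)
  define f where "f v = (perm (fst (wachs_decomposition n v)), snd (wachs_decomposition n v))" for v
  have po: "partial_order (wachs_poset n)" "partial_order ?Q"
    using assms m by (auto intro!: partial_order_wachs_poset partial_order_prod_poset
      partial_order_B_poset partial_order_powerset_poset)
  have dec: "biclosed m (fst (wachs_decomposition n v))" "snd (wachs_decomposition n v) \<subseteq> {1..n div 2}"
    if "v \<in> signed_wachs n" for v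
    using wachs_decomposition_in[OF that, folded m_def] by auto
  have le_iff: "f u \<sqsubseteq>\<^bsub>?Q\<^esub> f v \<longleftrightarrow> u \<sqsubseteq>\<^bsub>wachs_poset n\<^esub> v"
    if "u \<in> carrier (wachs_poset n)" "v \<in> carrier (wachs_poset n)" for u v
    using that dec weak_le_iff_wachs_decomposition[OF assms] weak_le_iff_inversions_subset[OF m]
    by (simp add: wachs_poset_def prod_poset_def B_poset_def powerset_poset_def f_def
        perm_in inversions_perm)
  have f_in: "f v \<in> carrier ?Q" if "v \<in> carrier (wachs_poset n)" for v
    using that dec perm_in by (simp add: wachs_poset_def prod_poset_def B_poset_def powerset_poset_def f_def)
  have "bij_betw f (carrier (wachs_poset n)) (carrier ?Q)"
  proof (rule bij_betw_imageI)
    show "inj_on f (carrier (wachs_poset n))"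
    proof (rule inj_onI)
      fix u v assume uv: "u \<in> carrier (wachs_poset n)" "v \<in> carrier (wachs_poset n)" "f u = f v"
      interpret W: partial_order "wachs_poset n" by (fact po(1))
      interpret Q: partial_order ?Q by (fact po(2))
      \<comment> \<open>Equal images are comparable both ways; \<open>le_iff\<close> reflects this
        to \<open>u\<close> and \<open>v\<close>, and antisymmetry finishes.\<close>
      show "u = v"
        using uv le_iff[of u v] le_iff[of v u] f_in[of v] by (metis Q.le_refl W.le_antisym)
    qed
    show "f ` carrier (wachs_poset n) = carrier ?Q"
    proof (intro subset_antisym subsetI)
      fix q assume "q \<in> carrier ?Q"
      then obtain u X where q: "q = (u, X)" "u \<in> signed_perms m" "X \<subseteq> {1..n div 2}"
        by (auto simp: prod_poset_def B_poset_def powerset_poset_def)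
      obtain v where "v \<in> signed_wachs n" "wachs_decomposition n v = (inversions m u, X)"
        using wachs_decomposition_surj[OF assms biclosed_inversions[OF q(2), unfolded m_def] q(3), folded m_def] .
      then show "q \<in> f ` carrier (wachs_poset n)"
        using q perm_inversions by (force simp: wachs_poset_def f_def)
    qed (use f_in in auto)
  qed
  moreover have "order_emb (wachs_poset n) ?Q f"
    using po le_iff by (simp add: order_emb_def partial_order_def)
  ultimately show ?thesis using po unfolding poset_isomorphic_def m_def by blast
qed

text \<open>Bounds and complements are built coordinatewise on pairs of a biclosed set and a set of
  blocks, then realised by \<open>wachs_decomposition_surj\<close>.\<close>

lemma wachs_poset_complemented_bounded_lattice:
  assumes "n > 0"
  shows "complemented_bounded_lattice (wachs_poset n)"
proof -
  define m where "m = (n + 1) div 2"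
  let ?A = "increasing_pairs m" and ?B = "{1..n div 2}"
  let ?J = "\<lambda>v. fst (wachs_decomposition n v)" and ?X = "\<lambda>v. snd (wachs_decomposition n v)"
  have dec: "biclosed m (?J v)" "?J v \<subseteq> ?A" "?X v \<subseteq> ?B" if "v \<in> signed_wachs n" for v
    using wachs_decomposition_in[OF that, folded m_def] biclosed_subset[of m "?J v"] by auto
  have surj: "\<exists>v\<in>signed_wachs n. ?J v = J \<and> ?X v = X" if "biclosed m J" "X \<subseteq> ?B" for J X
    using wachs_decomposition_surj[OF assms that[unfolded m_def]] by (metis fst_conv snd_conv)
  have le_iff: "weak_le n u v \<longleftrightarrow> ?J u \<subseteq> ?J v \<and> ?X u \<subseteq> ?X v"
    if "u \<in> signed_wachs n" "v \<in> signed_wachs n" for u v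
    using weak_le_iff_wachs_decomposition[OF assms that] .
  have bi_empty: "biclosed m {}" by (simp add: biclosed_def)
  have bi_all: "biclosed m ?A" using biclosed_complement[OF bi_empty] by simp
  obtain b where b: "b \<in> signed_wachs n" "?J b = {}" "?X b = {}" using surj[OF bi_empty, of "{}"] by auto
  obtain t where t: "t \<in> signed_wachs n" "?J t = ?A" "?X t = ?B" using surj[OF bi_all, of ?B] by auto
  have car: "carrier (wachs_poset n) = signed_wachs n" and le: "le (wachs_poset n) = weak_le n"
    by (simp_all add: wachs_poset_def)
  show ?thesis
  proof (rule complemented_bounded_latticeI[OF partial_order_wachs_poset[OF assms], of b t],
      unfold car le)
    show "b \<in> signed_wachs n" "t \<in> signed_wachs n" by fact+
    show "weak_le n b x" "weak_le n x t" if "x \<in> signed_wachs n" for x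
      using that b t dec by (simp_all add: le_iff)
  next
    fix x y assume xy: "x \<in> signed_wachs n" "y \<in> signed_wachs n"
    \<comment> \<open>Least biclosed set above both: any biclosed set containing the union is
      transitive, hence contains its closure.\<close>
    let ?U = "(?J x \<union> ?J y)\<^sup>+"
    have U_least: "?U \<subseteq> J" if "biclosed m J" "?J x \<subseteq> J" "?J y \<subseteq> J" for J
    proof -
      have "trans J" using biclosed_trans[OF that(1)] by (auto intro: transI)
      then show ?thesis using that(2,3) trancl_mono_subset[of "?J x \<union> ?J y" J] by (simp add: trancl_id)
    qed
    obtain s where s: "s \<in> signed_wachs n" "?J s = ?U" "?X s = ?X x \<union> ?X y"
      using surj[OF biclosed_trancl_Un, of "?J x" "?J y" "?X x \<union> ?X y"] dec xy by auto
    show "\<exists>s\<in>signed_wachs n. weak_le n x s \<and> weak_le n y s \<and>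
        (\<forall>z\<in>signed_wachs n. weak_le n x z \<longrightarrow> weak_le n y z \<longrightarrow> weak_le n s z)"
    proof (intro bexI conjI ballI impI)
      show "weak_le n x s" "weak_le n y s" using xy s by (auto simp: le_iff)
      show "weak_le n s z" if "z \<in> signed_wachs n" "weak_le n x z" "weak_le n y z" for z
        using that xy s dec(1)[of z] U_least[of "?J z"] by (simp add: le_iff)
    qed fact
  next
    fix x y assume xy: "x \<in> signed_wachs n" "y \<in> signed_wachs n"
    \<comment> \<open>De Morgan: the meet is the complement of the join of the complements.\<close>
    let ?U = "((?A - ?J x) \<union> (?A - ?J y))\<^sup>+"
    have U_least: "J \<subseteq> ?A - ?U" if "biclosed m J" "J \<subseteq> ?J x" "J \<subseteq> ?J y" for J
    proof -
      have "trans (?A - J)" using biclosed_trans[OF biclosed_complement[OF that(1)]] by (auto intro: transI)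
      then have "?U \<subseteq> ?A - J"
        using that(2,3) trancl_mono_subset[of "(?A - ?J x) \<union> (?A - ?J y)" "?A - J"]
        by (auto simp: trancl_id)
      then show ?thesis using biclosed_subset[OF that(1)] by auto
    qed
    have "biclosed m (?A - ?U)" using dec(1) xy by (intro biclosed_complement biclosed_trancl_Un)
    moreover have "?X x \<inter> ?X y \<subseteq> ?B" using dec(3)[OF xy(1)] by auto
    ultimately obtain s where s: "s \<in> signed_wachs n" "?J s = ?A - ?U" "?X s = ?X x \<inter> ?X y"
      using surj by blast
    have "?J s \<subseteq> ?J x" "?J s \<subseteq> ?J y" unfolding s by (auto intro: r_into_trancl)
    show "\<exists>s\<in>signed_wachs n. weak_le n s x \<and> weak_le n s y \<and>
        (\<forall>z\<in>signed_wachs n. weak_le n z x \<longrightarrow> weak_le n z y \<longrightarrow> weak_le n z s)"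
    proof (intro bexI conjI ballI impI)
      show "weak_le n s x" "weak_le n s y"
        using xy s(1,3) \<open>?J s \<subseteq> ?J x\<close> \<open>?J s \<subseteq> ?J y\<close> by (auto simp: le_iff)
      show "weak_le n z s" if "z \<in> signed_wachs n" "weak_le n z x" "weak_le n z y" for z
        using that xy s dec(1)[of z] U_least[of "?J z"] by (simp add: le_iff)
    qed fact
  next
    fix x assume x: "x \<in> signed_wachs n"
    \<comment> \<open>Complementing both coordinates works: sets below both are empty, and sets
      above both are everything.\<close>
    obtain y where y: "y \<in> signed_wachs n" "?J y = ?A - ?J x" "?X y = ?B - ?X x"
      using surj[OF biclosed_complement, of "?J x" "?B - ?X x"] dec x by auto
    show "\<exists>y\<in>signed_wachs n. (\<forall>z\<in>signed_wachs n. weak_le n z x \<longrightarrow> weak_le n z y \<longrightarrow> weak_le n z b) \<and>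
        (\<forall>z\<in>signed_wachs n. weak_le n x z \<longrightarrow> weak_le n y z \<longrightarrow> weak_le n t z)"
    proof (intro bexI conjI ballI impI)
      show "weak_le n z b" if "z \<in> signed_wachs n" "weak_le n z x" "weak_le n z y" for z
        using that x y b by (simp add: le_iff) blast
      show "weak_le n t z" if "z \<in> signed_wachs n" "weak_le n x z" "weak_le n y z" for z
        using that x y t by (simp add: le_iff) blast
    qed fact
  qed
qed

theorem theorem5p1:
  fixes n :: nat
  assumes "n > 0"
  shows "poset_isomorphic (wachs_poset n)
           (prod_poset (B_poset (nat \<lceil>real n / 2\<rceil>))
                       (powerset_poset {1..nat \<lfloor>real n / 2\<rfloor>}))
         \<and> complemented_bounded_lattice (wachs_poset n)"
proof -
  have "nat \<lfloor>real n / 2\<rfloor> = n div 2"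
    using floor_divide_of_nat_eq[of n 2, where ?'a = real] by simp
  moreover have "nat \<lceil>real n / 2\<rceil> = (n + 1) div 2" by linarith
  ultimately show ?thesis
    using wachs_poset_isomorphic[OF assms] wachs_poset_complemented_bounded_lattice[OF assms] by metis
qed

end
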